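(* (i) The function ${}_3F_2$ satisfies the Pfaff-like identity (near $x=0$) $${}_3F_2(a_1,a_2,e+1;\,b_1,e;\,x)=(1-x)^{-a_1}\,{}_3F_2\bigl(a_1,b_1-a_2-1,e'+1;\,b_1,e';\,\tfrac{x}{x-1}\bigr),$$ in which the $e\leftrightarrow e'$ correspondence is $$e'=\frac{(b_1-a_2-1)e}{e-a_2}.$$ (ii) The function ${}_3F_2$ satisfies the Euler-like identity (near $x=0$) $${}_3F_2(a_1,a_2,e+1;\,b_1,e;\,x)=(1-x)^{b_1-a_1-a_2-1}\,{}_3F_2(b_1-a_1-1,b_1-a_2-1,e''+1;\,b_1,e'';\,x),$$ in which the $e\leftrightarrow e''$ correspondence is $$e''=\frac{(b_1-a_1-1)(b_1-a_2-1)e}{(b_1-a_1-a_2-1)e+a_1a_2}.$$ Here $a_1,a_2,b_1\in\mathbb{C}$, and $e,e'$ (respectively $e,e''$) are taken to be finite. Also, the Möbius transformation $e\mapsto e'$ (respectively $e\mapsto e''$), which is of the lower triangular form $e\mapsto \frac{Ae}{Ce+D}$, is assumed to be nonsingular, which is the case if all upper parameters are nonzero, i.e. if neither ${}_3F_2$ is identically equal to unity.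
   Context: ${}_3F_2(a_1,a_2,a_3;b_1,b_2;x)=\sum_{n\ge0}\frac{(a_1)_n(a_2)_n(a_3)_n}{(b_1)_n(b_2)_n\,n!}x^n$ for $|x|<1$; the $a_i$ are the upper parameters and the $b_i$ the lower parameters. Lower parameters of every ${}_3F_2$ that appears are assumed not to be nonpositive integers. Powers of $1-x$ equal $1$ at $x=0$. *)

theory Defs
  imports "HOL-Analysis.Analysis"
begin

text \<open>Meaningful for \<open>norm x < 1\<close> and \<open>b1, b2 \<notin> \<int>\<^sub>\<le>\<^sub>0\<close>; outside this range the series may
  diverge, or its terms involve division by zero.\<close>

definition hypergeo_3F2 ::
  "complex \<Rightarrow> complex \<Rightarrow> complex \<Rightarrow> complex \<Rightarrow> complex \<Rightarrow> complex \<Rightarrow> complex" where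
  "hypergeo_3F2 a1 a2 a3 b1 b2 x =
     (\<Sum>n. pochhammer a1 n * pochhammer a2 n * pochhammer a3 n /
           (pochhammer b1 n * pochhammer b2 n * fact n) * x ^ n)"

lemma hypergeo_3F2_eq_eval_fps:
  "hypergeo_3F2 a1 a2 a3 b1 b2 x = eval_fps (fps_hypergeo [a1, a2, a3] [b1, b2] 1) x"
  by (simp add: hypergeo_3F2_def eval_fps_def fps_hypergeo_def)

text \<open>Nonsingularity of the transformation \<^term>\<open>moebius A B C D\<close>, i.e. of
  \<open>e \<mapsto> (A * e + B) / (C * e + D)\<close>.\<close>

definition moebius_nonsingular :: "complex \<Rightarrow> complex \<Rightarrow> complex \<Rightarrow> complex \<Rightarrow> bool" where
  "moebius_nonsingular A B C D \<longleftrightarrow> A * D - B * C \<noteq> 0"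

end

theory Submission
  imports Defs "HOL-Complex_Analysis.Laurent_Convergence"
begin

text \<open>
  Since \<open>(e + 1)\<^sub>n / (e)\<^sub>n = 1 + n / e\<close>, the series on the left is a Gauss series whose \<open>n\<close>-th
  term is multiplied by the linear weight \<open>1 + n s\<close> with \<open>s = 1 / e\<close>. In terms of \<open>s\<close> the two
  Moebius transformations of the parameter \<open>e\<close> become affine:
  \<open>(c - b - 1) s' = 1 - b s\<close> and \<open>(c - a - 1) (c - b - 1) s'' = (c - a - b - 1) + a b s\<close>,
  where \<open>a, b, c\<close> stand for the parameters \<open>a\<^sub>1, a\<^sub>2, b\<^sub>1\<close>.

  For the Pfaff-like identity, expand each term of
  \<open>(1 - x)\<^sup>-\<^sup>a \<Sum>\<^sub>k F\<^sub>k (x / (x - 1))\<^sup>k = \<Sum>\<^sub>k F\<^sub>k (-x)\<^sup>k (1 - x)\<^sup>-\<^sup>a\<^sup>-\<^sup>k\<close>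
  by the binomial series. The coefficient of \<open>x\<^sup>n\<close> is a terminating hypergeometric sum at
  argument 1 with the weight \<open>1 + k s'\<close>; splitting off the part with the factor \<open>k\<close> gives two
  Chu-Vandermonde sums (lemma \<open>weighted_Chu_Vandermonde\<close>). The computation takes place in formal
  power series (lemma \<open>fps_weighted_Pfaff\<close>), and the positive radii of convergence carry it over to
  functions near 0, which avoids interchanging infinite sums.

  The Euler-like identity is the Pfaff-like one applied twice, the second time with the first two
  upper parameters exchanged, because \<open>x \<mapsto> x / (x - 1)\<close> is an involution and
  \<open>1 - x / (x - 1) = 1 / (1 - x)\<close>. The intermediate parameter \<open>s'\<close> may vanish (if \<open>e = b\<close>) or its
  reciprocal may be a nonpositive integer; neither does any harm to the weight \<open>1 + n s'\<close>, whereas the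
  corresponding \<open>\<^sub>3F\<^sub>2\<close> would be undefined. This is why all identities are proved
  for weighted series with arbitrary \<open>s\<close> first.
\<close>

section \<open>Weighted Gauss series\<close>

text \<open>The value \<open>s = 1 / e\<close> yields \<open>\<^sub>3F\<^sub>2(a, b, e + 1; c, e; x)\<close>; the value \<open>s = 0\<close> yields the
  Gauss series \<open>\<^sub>2F\<^sub>1(a, b; c; x)\<close> as the limiting case \<open>e = \<infinity>\<close>.\<close>

definition fps_hyp_weighted :: "complex \<Rightarrow> complex \<Rightarrow> complex \<Rightarrow> complex \<Rightarrow> complex fps" where
  "fps_hyp_weighted a b c s =
     Abs_fps (\<lambda>n. pochhammer a n * pochhammer b n / (pochhammer c n * fact n) * (1 + of_nat n * s))"

lemma fps_hyp_weighted_commute: "fps_hyp_weighted a b c s = fps_hyp_weighted b a c s"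
  by (simp add: fps_hyp_weighted_def mult.commute)

lemma hypergeo_3F2_eq_weighted:
  assumes "e \<notin> \<int>\<^sub>\<le>\<^sub>0"
  shows   "hypergeo_3F2 a b (e + 1) c e x = eval_fps (fps_hyp_weighted a b c (1 / e)) x"
proof -
  have [simp]: "e \<noteq> 0" using assms by auto
  have nz: "pochhammer e n \<noteq> 0" for n
    using assms by (auto simp: pochhammer_eq_0_iff)
  have shift: "pochhammer (e + 1) n = pochhammer e n * (1 + of_nat n * (1 / e))" for n
    using pochhammer_rec[of e n] pochhammer_Suc[of e n] by (simp add: field_simps)
  have *: "pochhammer a n * pochhammer b n * pochhammer (e + 1) n /
           (pochhammer c n * pochhammer e n * fact n) = fps_nth (fps_hyp_weighted a b c (1 / e)) n" for n
    unfolding shift using nz by (simp add: fps_hyp_weighted_def del: times_divide_eq_right)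
  show ?thesis
    unfolding hypergeo_3F2_def eval_fps_def * ..
qed

text \<open>In a terminating series the quotients of successive terms are not eventually defined, so the
  ratio test in terms of their limit does not apply; a bound without division covers this case.\<close>

lemma conv_radius_pos_if_ratio_bounded:
  fixes f :: "nat \<Rightarrow> 'a :: {banach, real_normed_div_algebra}"
  assumes "eventually (\<lambda>n. norm (f (Suc n)) \<le> C * norm (f n)) sequentially" "C > 0"
  shows   "conv_radius f > 0"
proof -
  let ?z = "of_real (inverse (2 * C)) :: 'a"
  obtain N where N: "\<And>n. n \<ge> N \<Longrightarrow> norm (f (Suc n)) \<le> C * norm (f n)"
    using assms(1) by (auto simp: eventually_sequentially)
  have nz: "norm ?z = inverse (2 * C)" using \<open>C > 0\<close> by (simp only: norm_of_real) simp
  have "summable (\<lambda>n. f n * ?z ^ n)"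
  proof (rule summable_ratio_test)
    fix n assume "n \<ge> N"
    have "norm (f (Suc n) * ?z ^ Suc n) = norm (f (Suc n)) * (inverse (2 * C)) ^ Suc n"
      by (simp only: norm_mult norm_power nz)
    also have "\<dots> \<le> (C * norm (f n)) * (inverse (2 * C)) ^ Suc n"
      by (intro mult_right_mono N \<open>n \<ge> N\<close>) (use \<open>C > 0\<close> in auto)
    also have "\<dots> = 1 / 2 * (norm (f n) * (inverse (2 * C)) ^ n)"
      using \<open>C > 0\<close> by (simp add: field_simps)
    also have "\<dots> = 1 / 2 * norm (f n * ?z ^ n)"
      by (simp only: norm_mult norm_power nz)
    finally show "norm (f (Suc n) * ?z ^ Suc n) \<le> 1 / 2 * norm (f n * ?z ^ n)" .
  qed auto
  hence "conv_radius f \<ge> norm ?z" by (rule conv_radius_geI)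
  moreover have "norm ?z > 0" using nz \<open>C > 0\<close> by simp
  ultimately show ?thesis by (metis ereal_less(2) less_le_trans)
qed

text \<open>With \<open>G\<close> the Gauss series, the weighted series is \<open>G + s x G'\<close>. This reduces the claim to the
  ratio test for \<open>G\<close>, so that a possible zero of the weight \<open>1 + n s\<close> needs no separate treatment.\<close>

lemma fps_conv_radius_hyp_weighted:
  "fps_conv_radius (fps_hyp_weighted a b c s) > 0"
proof -
  define G where "G = fps_hyp_weighted a b c 0"
  define r where "r = (\<lambda>n. (a + of_nat n) * (b + of_nat n) / ((c + of_nat n) * (1 + of_nat n)))"
  have ratio: "fps_nth G (Suc n) = r n * fps_nth G n" for n
    by (simp add: G_def fps_hyp_weighted_def r_def pochhammer_Suc field_simps)
  have lim: "r \<longlonglongrightarrow> 1"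
  proof -
    have 1: "(\<lambda>n. x / of_nat n) \<longlonglongrightarrow> 0" for x :: complex
      by (rule lim_const_over_n)
    have "(\<lambda>n. (a / of_nat n + 1) * (b / of_nat n + 1) /
                 ((c / of_nat n + 1) * (1 / of_nat n + 1))) \<longlonglongrightarrow> (0 + 1) * (0 + 1) / ((0 + 1) * (0 + 1))"
      by (intro tendsto_intros 1) auto
    moreover have "eventually (\<lambda>n. (a / of_nat n + 1) * (b / of_nat n + 1) /
                 ((c / of_nat n + 1) * (1 / of_nat n + 1)) = r n) sequentially"
      using eventually_gt_at_top[of 0]
    proof eventually_elim
      case (elim n)
      have "x / of_nat n + 1 = (x + of_nat n) / of_nat n" for x :: complex
        using elim by (simp add: field_simps)
      thus ?case using elim by (simp add: r_def)
    qed
    ultimately show ?thesis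
      by (simp add: tendsto_cong)
  qed
  have "eventually (\<lambda>n. norm (r n) < 2) sequentially"
    using tendsto_norm[OF lim] by (rule order_tendstoD) auto
  hence "eventually (\<lambda>n. norm (fps_nth G (Suc n)) \<le> 2 * norm (fps_nth G n)) sequentially"
    by eventually_elim (auto simp: ratio norm_mult intro!: mult_right_mono)
  hence rad: "fps_conv_radius G > 0"
    unfolding fps_conv_radius_def by (rule conv_radius_pos_if_ratio_bounded) auto
  have "fps_hyp_weighted a b c s = G + fps_const s * (fps_X * fps_deriv G)"
  proof (rule fps_ext)
    fix n
    have "fps_nth (fps_X * fps_deriv G) n = of_nat n * fps_nth G n"
      by (cases n) auto
    hence "fps_nth (G + fps_const s * (fps_X * fps_deriv G)) n = fps_nth G n * (1 + of_nat n * s)"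
      by (simp only: fps_add_nth fps_mult_left_const_nth) (simp add: algebra_simps)
    thus "fps_nth (fps_hyp_weighted a b c s) n =
            fps_nth (G + fps_const s * (fps_X * fps_deriv G)) n"
      by (simp add: fps_hyp_weighted_def G_def)
  qed
  moreover have "(\<lambda>x. eval_fps G x + s * (x * deriv (eval_fps G) x)) has_fps_expansion
                   (G + fps_const s * (fps_X * fps_deriv G))"
    by (intro fps_expansion_intros eval_fps_has_fps_expansion rad)
  ultimately show ?thesis
    by (simp add: has_fps_expansion_def)
qed

section \<open>The Pfaff-like identity\<close>

text \<open>These are the coefficients of the binomial series of \<open>(1 - x)\<^sup>-\<^sup>a\<close>.\<close>

lemma fps_binomial_compose_uminus_X_nth:
  fixes a :: "'a :: field_char_0"
  shows "fps_nth (fps_binomial (-a) oo (-fps_X)) n = pochhammer a n / fact n"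
  by (simp add: fps_compose_uminus' gbinomial_pochhammer flip: mult.assoc power_mult_distrib)

lemma has_fps_expansion_one_minus_powr:
  "(\<lambda>x::complex. (1 - x) powr a) has_fps_expansion (fps_binomial a oo (-fps_X))"
proof -
  have "((\<lambda>x::complex. (1 + x) powr a) \<circ> uminus) has_fps_expansion (fps_binomial a oo (-fps_X))"
    by (intro has_fps_expansion_compose fps_expansion_intros) auto
  thus ?thesis by (simp add: o_def)
qed

text \<open>A product \<open>H(x) \<Sum>\<^sub>k F\<^sub>k G(x)\<^sup>k\<close> may be expanded term by term. Only \<open>k \<le> n\<close> contribute
  to the coefficient of \<open>x\<^sup>n\<close>, because \<open>G\<^sup>k\<close> starts with \<open>x\<^sup>k\<close> or later.\<close>

lemma fps_mult_compose_nth: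
  fixes F G H :: "'a :: comm_ring_1 fps"
  assumes "fps_nth G 0 = 0"
  shows   "fps_nth (H * (F oo G)) n = (\<Sum>k=0..n. fps_nth F k * fps_nth (G ^ k * H) n)"
proof -
  have "fps_nth (F oo G) i = (\<Sum>k=0..n. fps_nth F k * fps_nth (G ^ k) i)" if "i \<le> n" for i
    unfolding fps_compose_nth using that assms
    by (intro sum.mono_neutral_left) (auto simp: startsby_zero_power_prefix)
  hence "fps_nth ((F oo G) * H) n =
          (\<Sum>i=0..n. (\<Sum>k=0..n. fps_nth F k * fps_nth (G ^ k) i) * fps_nth H (n - i))"
    by (simp add: fps_mult_nth)
  also have "\<dots> = (\<Sum>k=0..n. fps_nth F k * fps_nth (G ^ k * H) n)"
    unfolding fps_mult_nth sum_distrib_left sum_distrib_right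
    by (subst sum.swap) (simp add: mult.assoc)
  finally show ?thesis by (simp add: mult.commute)
qed

text \<open>The part of the sum without \<open>s'\<close> is the Chu-Vandermonde sum with parameters \<open>d, c, n\<close>. In the
  other part, \<open>k / k! = 1 / (k - 1)!\<close> turns the summand into a multiple of the one for
  \<open>d + 1, c + 1, n - 1\<close>. Both results contain \<open>(b + 1)\<^sub>n\<^sub>-\<^sub>1 / (c)\<^sub>n\<close>; their remaining factors add up
  to \<open>b + n - n d s'\<close>, and the relation between \<open>s\<close> and \<open>s'\<close> is exactly what makes this equal to
  \<open>b (1 + n s)\<close>.\<close>

lemma weighted_Chu_Vandermonde:
  fixes b c d s s' :: complex
  assumes c: "c \<notin> \<int>\<^sub>\<le>\<^sub>0" and d: "d = c - b - 1" and s': "d * s' = 1 - b * s"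
  shows "(\<Sum>k=0..n. pochhammer d k * pochhammer (-of_nat n) k / (fact k * pochhammer c k)
                 * (1 + of_nat k * s')) = pochhammer b n / pochhammer c n * (1 + of_nat n * s)"
proof (cases n)
  case (Suc m)
  have shift: "c + 1 \<noteq> - of_nat i" "c \<noteq> - of_nat i" for i
  proof -
    show "c \<noteq> - of_nat i" for i using c by auto
    from this[of "Suc i"] show "c + 1 \<noteq> - of_nat i" by (auto simp: algebra_simps eq_neg_iff_add_eq_0)
  qed
  have nz: "pochhammer c n \<noteq> 0" "pochhammer (c + 1) n \<noteq> 0" "c \<noteq> 0" for n
    using shift shift(2)[of 0] by (auto simp: pochhammer_eq_0_iff)
  let ?t = "\<lambda>d c n k. pochhammer d k * pochhammer (-of_nat n) k / (fact k * pochhammer c k) :: complex"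
  have Chu_Vandermonde: "(\<Sum>k=0..n. ?t d c n k) = pochhammer (c - d) n / pochhammer c n"
    if "\<And>i. c \<noteq> - of_nat i" for d c n
    using Vandermonde_pochhammer[of n c d] that by simp
  have "(\<Sum>k=0..n. ?t d c n k * (1 + of_nat k * s')) =
          (\<Sum>k=0..n. ?t d c n k) + s' * (\<Sum>k=0..n. of_nat k * ?t d c n k)"
    unfolding sum_distrib_left sum.distrib [symmetric]
    by (intro sum.cong refl) (simp only: ring_distribs mult_ac mult_1_right mult_1_left)
  also have "(\<Sum>k=0..n. ?t d c n k) = pochhammer (b + 1) n / pochhammer c n"
    by (subst Chu_Vandermonde) (simp_all add: shift d)
  also have "(\<Sum>k=0..n. of_nat k * ?t d c n k) = (\<Sum>k=0..m. of_nat (Suc k) * ?t d c n (Suc k))"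
    unfolding Suc by (subst sum.atLeast0_atMost_Suc_shift) simp
  also have "\<dots> = (\<Sum>k=0..m. - (of_nat n * d / c) * ?t (d + 1) (c + 1) m k)"
  proof (rule sum.cong)
    fix k
    have "(-of_nat n + 1 :: complex) = -of_nat m" by (simp add: Suc)
    moreover have "of_nat (Suc k) / fact (Suc k) = (1 / fact k :: complex)"
      by (simp add: field_simps del: of_nat_Suc)
    ultimately show "of_nat (Suc k) * ?t d c n (Suc k) = - (of_nat n * d / c) * ?t (d + 1) (c + 1) m k"
      unfolding pochhammer_rec by (simp add: divide_simps del: of_nat_Suc)
  qed auto
  also have "\<dots> = - (of_nat n * d / c) * (pochhammer (c - d) m / pochhammer (c + 1) m)"
    unfolding sum_distrib_left [symmetric] by (subst Chu_Vandermonde) (simp_all add: shift)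
  also have "\<dots> = - (of_nat n * d) * pochhammer (b + 1) m / pochhammer c n"
    unfolding Suc pochhammer_rec[of c] using nz by (simp add: d)
  also have "pochhammer (b + 1) n = pochhammer (b + 1) m * (b + of_nat n)"
    by (simp add: Suc pochhammer_Suc add_ac)
  also have "pochhammer (b + 1) m * (b + of_nat n) / pochhammer c n +
               s' * (- (of_nat n * d) * pochhammer (b + 1) m / pochhammer c n) =
             pochhammer (b + 1) m * (b + of_nat n - of_nat n * (d * s')) / pochhammer c n"
    by (simp add: diff_divide_distrib ring_distribs mult_ac)
  also have "\<dots> = pochhammer b n / pochhammer c n * (1 + of_nat n * s)"
    unfolding s' by (simp add: Suc pochhammer_rec algebra_simps)
  finally show ?thesis .
qed auto

text \<open>The argument \<open>x / (x - 1)\<close> is represented as \<open>-x (1 - x)\<^sup>-\<^sup>1\<close>, so that its powers multiply with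
  \<open>(1 - x)\<^sup>-\<^sup>a\<close> to \<open>(-x)\<^sup>k (1 - x)\<^sup>-\<^sup>a\<^sup>-\<^sup>k\<close>.\<close>

lemma fps_weighted_Pfaff:
  fixes a b c d s s' :: complex
  assumes "c \<notin> \<int>\<^sub>\<le>\<^sub>0" and "d = c - b - 1" and "d * s' = 1 - b * s"
  shows "(fps_binomial (-a) oo (-fps_X)) *
           (fps_hyp_weighted a d c s' oo (-fps_X * (fps_binomial (-1) oo (-fps_X)))) =
         fps_hyp_weighted a b c s"
proof (rule fps_ext)
  fix n :: nat
  \<comment> \<open>the series of \<open>(1 - x)\<^sup>-\<^sup>a\<close>\<close>
  define B where "B = (\<lambda>a::complex. fps_binomial (-a) oo (-fps_X))"
  have B_nth: "fps_nth (B a) n = pochhammer a n / fact n" for a n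
    unfolding B_def by (rule fps_binomial_compose_uminus_X_nth)
  have B_add: "B (x + y) = B x * B y" for x y
    using fps_binomial_add_mult[of "-x" "-y"]
    unfolding B_def by (simp add: fps_compose_mult_distrib)
  have B_power: "B 1 ^ k = B (of_nat k)" for k
    by (induction k) (simp_all add: B_add, simp add: B_def)
  have power: "(-fps_X * B 1) ^ k * B a = (-1) ^ k * fps_X ^ k * B (a + of_nat k)" for k
    by (simp only: B_add power_mult_distrib B_power power_minus[of fps_X] mult_ac)
  \<comment> \<open>Multiplied by \<open>(a)\<^sub>k\<close>, the coefficient depends on \<open>a\<close> only through \<open>(a)\<^sub>n\<close>. This factor
     leaves the sum over \<open>k\<close>, and a sum of Chu-Vandermonde type in \<open>c, d, n\<close> remains.\<close>
  have term_eq: "fps_nth ((-fps_X * B 1) ^ k * B a) n * pochhammer a k = 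
      pochhammer a n * pochhammer (-of_nat n) k / fact n" if "k \<le> n" for k
  proof -
    have "fps_nth ((-fps_X * B 1) ^ k * B a) n = (-1) ^ k * (pochhammer (a + of_nat k) (n - k) / fact (n - k))"
    proof -
      have "(-1) ^ k = fps_const ((-1) ^ k :: complex)"
        by (cases "even k") simp_all
      thus ?thesis
        unfolding power using that
        by (simp only: mult.assoc fps_mult_left_const_nth) (simp add: B_nth fps_X_power_mult_nth)
    qed
    moreover have "pochhammer a n = pochhammer a k * pochhammer (a + of_nat k) (n - k)"
      using that by (rule pochhammer_product)
    moreover have "pochhammer (-of_nat n) k = (-1) ^ k * (fact n / fact (n - k) :: complex)"
    proof -
      have "(-1) ^ k * pochhammer (-of_nat n) k / fact k = (fact n / (fact k * fact (n - k)) :: complex)"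
        using gbinomial_pochhammer[of "of_nat n :: complex" k] binomial_fact[OF that, where 'a = complex]
        by (simp add: binomial_gbinomial)
      thus ?thesis by (cases "even k") (simp_all add: field_simps, metis minus_minus)
    qed
    ultimately show ?thesis by simp
  qed
  have "fps_nth (B a * (fps_hyp_weighted a d c s' oo (-fps_X * B 1))) n =
        (\<Sum>k=0..n. fps_nth (fps_hyp_weighted a d c s') k * fps_nth ((-fps_X * B 1) ^ k * B a) n)"
    by (rule fps_mult_compose_nth) auto
  also have "\<dots> = (\<Sum>k=0..n. pochhammer a n / fact n * (pochhammer d k * pochhammer (-of_nat n) k / (fact k * pochhammer c k)
                 * (1 + of_nat k * s')))"
  proof (rule sum.cong)
    fix k assume "k \<in> {0..n}"
    have "fps_nth (fps_hyp_weighted a d c s') k * fps_nth ((-fps_X * B 1) ^ k * B a) n =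
          (fps_nth ((-fps_X * B 1) ^ k * B a) n * pochhammer a k) * 
            (pochhammer d k / (fact k * pochhammer c k) * (1 + of_nat k * s'))"
      by (simp add: fps_hyp_weighted_def mult_ac)
    also have "\<dots> = pochhammer a n / fact n * (pochhammer d k * pochhammer (-of_nat n) k / (fact k * pochhammer c k)
                 * (1 + of_nat k * s'))"
      by (subst term_eq) (use \<open>k \<in> _\<close> in auto)
    finally show "fps_nth (fps_hyp_weighted a d c s') k * fps_nth ((-fps_X * B 1) ^ k * B a) n = \<dots>" .
  qed auto
  also have "\<dots> = pochhammer a n / fact n * (pochhammer b n / pochhammer c n * (1 + of_nat n * s))"
    unfolding sum_distrib_left [symmetric] by (subst weighted_Chu_Vandermonde[OF assms]) auto
  also have "\<dots> = fps_nth (fps_hyp_weighted a b c s) n"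
    by (simp add: fps_hyp_weighted_def mult_ac)
  finally show "fps_nth ((fps_binomial (-a) oo (-fps_X)) *
           (fps_hyp_weighted a d c s' oo (-fps_X * (fps_binomial (-1) oo (-fps_X))))) n = \<dots>"
    by (simp add: B_def)
qed

lemma weighted_Pfaff:
  fixes a b c d s s' :: complex
  assumes "c \<notin> \<int>\<^sub>\<le>\<^sub>0" and "d = c - b - 1" and "d * s' = 1 - b * s"
  shows "\<forall>\<^sub>F x in nhds 0. eval_fps (fps_hyp_weighted a b c s) x =
           (1 - x) powr (-a) * eval_fps (fps_hyp_weighted a d c s') (x / (x - 1))"
proof -
  have "(\<lambda>x::complex. -x * (1 - x) powr (-1)) has_fps_expansion
           (-fps_X * (fps_binomial (-1) oo (-fps_X)))"
    by (intro fps_expansion_intros has_fps_expansion_one_minus_powr)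
  moreover have "-x * (1 - x) powr (-1) = x / (x - 1)" for x :: complex
    by (cases "x = 1") (auto simp: powr_minus field_simps)
  ultimately have g: "(\<lambda>x::complex. x / (x - 1)) has_fps_expansion
           (-fps_X * (fps_binomial (-1) oo (-fps_X)))"
    by simp
  have "(\<lambda>x. (1 - x) powr (-a) * (eval_fps (fps_hyp_weighted a d c s') \<circ> (\<lambda>x. x / (x - 1))) x)
          has_fps_expansion fps_hyp_weighted a b c s"
    unfolding fps_weighted_Pfaff[OF assms, of a, symmetric]
    by (intro has_fps_expansion_mult has_fps_expansion_one_minus_powr has_fps_expansion_compose g
          eval_fps_has_fps_expansion fps_conv_radius_hyp_weighted) auto
  thus ?thesis
    by (simp add: has_fps_expansion_def)
qed

section \<open>The Euler-like identity\<close>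

text \<open>Both steps are instances of lemma \<open>weighted_Pfaff\<close>: from \<open>(a, b, s)\<close> to \<open>(a, c - b - 1, s')\<close>, and, after
  an exchange of the upper parameters, from \<open>(c - b - 1, a, s')\<close> to
  \<open>(c - b - 1, c - a - 1, s'')\<close>.\<close>

lemma weighted_Euler:
  fixes a b c s s'' :: complex
  assumes c: "c \<notin> \<int>\<^sub>\<le>\<^sub>0" and b: "c - b - 1 \<noteq> 0"
    and s'': "(c - a - 1) * (c - b - 1) * s'' = (c - a - b - 1) + a * b * s"
  shows "\<forall>\<^sub>F x in nhds 0. eval_fps (fps_hyp_weighted a b c s) x =
           (1 - x) powr (c - a - b - 1) *
             eval_fps (fps_hyp_weighted (c - a - 1) (c - b - 1) c s'') x"
proof -
  define d where "d = c - b - 1"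
  define s' where "s' = (1 - b * s) / d"
  have s': "d * s' = 1 - b * s"
    using b by (simp add: s'_def d_def)
  have "d * ((c - a - 1) * s'') = d * (1 - a * s')"
  proof -
    have "d * (1 - a * s') = d - a * (d * s')" by (simp add: algebra_simps)
    also have "\<dots> = d - a * (1 - b * s)" by (simp only: s')
    also have "\<dots> = (c - a - 1) * d * s''" unfolding d_def s'' by (simp add: algebra_simps)
    finally show ?thesis by (simp only: mult_ac)
  qed
  hence "(c - a - 1) * s'' = 1 - a * s'"
    using b by (simp add: d_def)
  hence "\<forall>\<^sub>F y in nhds 0. eval_fps (fps_hyp_weighted d a c s') y =
           (1 - y) powr (-d) * eval_fps (fps_hyp_weighted d (c - a - 1) c s'') (y / (y - 1))"
    by (intro weighted_Pfaff c) auto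
  moreover have "filterlim (\<lambda>x::complex. x / (x - 1)) (nhds 0) (nhds 0)"
    by (auto intro!: tendsto_eq_intros filterlim_ident)
  ultimately have "\<forall>\<^sub>F x in nhds 0. eval_fps (fps_hyp_weighted d a c s') (x / (x - 1)) =
           (1 - x / (x - 1)) powr (-d) * 
           eval_fps (fps_hyp_weighted d (c - a - 1) c s'') ((x / (x - 1)) / ((x / (x - 1)) - 1))"
    by (rule eventually_compose_filterlim)
  moreover have "\<forall>\<^sub>F x in nhds 0. eval_fps (fps_hyp_weighted a b c s) x =
           (1 - x) powr (-a) * eval_fps (fps_hyp_weighted a d c s') (x / (x - 1))"
    by (intro weighted_Pfaff c d_def s')
  moreover have "\<forall>\<^sub>F x in nhds 0. x \<in> ball (0 :: complex) 1"
    by (intro eventually_nhds_in_open) auto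
  ultimately show ?thesis
  proof eventually_elim
    case (elim x)
    have x: "norm x < 1" using elim(3) by simp
    hence [simp]: "x \<noteq> 1" by auto
    \<comment> \<open>Away from the branch cut, the powers of \<open>1 - x\<close> and of its inverse are compatible.\<close>
    have "Re x < 1" using x complex_Re_le_cmod[of x] by linarith
    hence "1 - x \<notin> \<real>\<^sub>\<le>\<^sub>0" by (auto simp: complex_nonpos_Reals_iff)
    moreover have "1 - x / (x - 1) = inverse (1 - x)" 
      by (simp add: divide_simps)
    ultimately have "(1 - x / (x - 1)) powr (-d) = (1 - x) powr d"
      by (simp add: powr_def Ln_inverse)
    moreover have "(x / (x - 1)) / ((x / (x - 1)) - 1) = x"
      by (simp add: divide_simps)
    moreover have "(1 - x) powr (-a) * (1 - x) powr d = (1 - x) powr (c - a - b - 1)"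
      by (simp add: d_def flip: powr_add) (simp add: algebra_simps)
    ultimately show ?case
      using elim(1,2) fps_hyp_weighted_commute[of a d] fps_hyp_weighted_commute[of d "c - a - 1"]
      by (simp add: d_def flip: mult.assoc)
  qed
qed

theorem theorem6p1:
  fixes a1 a2 b1 e :: complex
  assumes "b1 \<notin> \<int>\<^sub>\<le>\<^sub>0" and "e \<notin> \<int>\<^sub>\<le>\<^sub>0"
  shows "(\<forall>e'. moebius_nonsingular (b1 - a2 - 1) 0 1 (- a2) \<longrightarrow>
            e - a2 \<noteq> 0 \<longrightarrow>
            e' = (b1 - a2 - 1) * e / (e - a2) \<longrightarrow>
            e' \<notin> \<int>\<^sub>\<le>\<^sub>0 \<longrightarrow>
            (\<forall>\<^sub>F x in nhds 0.
               hypergeo_3F2 a1 a2 (e + 1) b1 e x =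
               (1 - x) powr (- a1) *
                 hypergeo_3F2 a1 (b1 - a2 - 1) (e' + 1) b1 e' (x / (x - 1))))
       \<and> (\<forall>e''. moebius_nonsingular ((b1 - a1 - 1) * (b1 - a2 - 1)) 0
                  (b1 - a1 - a2 - 1) (a1 * a2) \<longrightarrow>
            (b1 - a1 - a2 - 1) * e + a1 * a2 \<noteq> 0 \<longrightarrow>
            e'' = (b1 - a1 - 1) * (b1 - a2 - 1) * e / ((b1 - a1 - a2 - 1) * e + a1 * a2) \<longrightarrow>
            e'' \<notin> \<int>\<^sub>\<le>\<^sub>0 \<longrightarrow>
            (\<forall>\<^sub>F x in nhds 0.
               hypergeo_3F2 a1 a2 (e + 1) b1 e x =
               (1 - x) powr (b1 - a1 - a2 - 1) *
                 hypergeo_3F2 (b1 - a1 - 1) (b1 - a2 - 1) (e'' + 1) b1 e'' x))"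
proof (intro conjI allI impI)
  have [simp]: "e \<noteq> 0" using assms(2) by auto
  fix e' assume e': "e' = (b1 - a2 - 1) * e / (e - a2)" "e' \<notin> \<int>\<^sub>\<le>\<^sub>0" "e - a2 \<noteq> 0"
  have "b1 - a2 - 1 \<noteq> 0" using e' by auto
  hence "(b1 - a2 - 1) * (1 / e') = 1 - a2 * (1 / e)"
    unfolding e'(1) by (simp add: diff_divide_distrib right_diff_distrib)
  from weighted_Pfaff[OF assms(1) refl this]
  show "\<forall>\<^sub>F x in nhds 0. hypergeo_3F2 a1 a2 (e + 1) b1 e x = (1 - x) powr (- a1) *
                 hypergeo_3F2 a1 (b1 - a2 - 1) (e' + 1) b1 e' (x / (x - 1))"
    by (simp only: hypergeo_3F2_eq_weighted assms(2) e'(2) not_False_eq_True)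
next
  have [simp]: "e \<noteq> 0" using assms(2) by auto
  fix e'' assume e'': "e'' = (b1 - a1 - 1) * (b1 - a2 - 1) * e / ((b1 - a1 - a2 - 1) * e + a1 * a2)"
    "e'' \<notin> \<int>\<^sub>\<le>\<^sub>0" "(b1 - a1 - a2 - 1) * e + a1 * a2 \<noteq> 0"
  have nz: "b1 - a1 - 1 \<noteq> 0" "b1 - a2 - 1 \<noteq> 0" using e'' by auto
  have "(b1 - a1 - 1) * (b1 - a2 - 1) * (1 / e'') = ((b1 - a1 - a2 - 1) * e + a1 * a2) / e"
    unfolding e''(1) using nz by simp
  also have "\<dots> = (b1 - a1 - a2 - 1) + a1 * a2 * (1 / e)"
    by (simp add: add_divide_distrib)
  finally show "\<forall>\<^sub>F x in nhds 0. hypergeo_3F2 a1 a2 (e + 1) b1 e x =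
       (1 - x) powr (b1 - a1 - a2 - 1) *
         hypergeo_3F2 (b1 - a1 - 1) (b1 - a2 - 1) (e'' + 1) b1 e'' x"
    using weighted_Euler[OF assms(1) nz(2)]
    by (simp only: hypergeo_3F2_eq_weighted assms(2) e''(2) not_False_eq_True)
qed

end
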